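(* For any finite set $S$ of positive integers, the sequence $(d_n(S))_{n\ge0}$ is log-concave, i.e. $d_n(S)^2\ge d_{n-1}(S)\,d_{n+1}(S)$ for all $n\ge1$.
   Context: $\mathfrak S_n$ is the set of permutations $\pi=\pi_1\pi_2\ldots\pi_n$ of $[n]=\{1,\ldots,n\}$ in one-line notation. The descent set of $\pi$ is $\mathrm{Des}\,\pi=\{i\mid\pi_i>\pi_{i+1}\}$ (a subset of $\{1,\ldots,n-1\}$). For a finite set $S$ of positive integers, $D_n(S)=\{\pi\in\mathfrak S_n\mid\mathrm{Des}\,\pi=S\}$ and $d_n(S)=\#D_n(S)$. *)

theory Defs
  imports Main "HOL-Combinatorics.Permutations"
begin

text \<open>
  A permutation \<open>\<pi>\<close> of \<open>[n]\<close> is a function with \<open>\<pi> permutes {1..n}\<close>; its one-line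
  notation is \<open>\<pi> 1, \<dots>, \<pi> n\<close>.  For \<open>n = 0\<close> there is exactly one such function.
\<close>

definition Des :: "nat \<Rightarrow> (nat \<Rightarrow> nat) \<Rightarrow> nat set" where
  "Des n \<pi> = {i. 1 \<le> i \<and> i < n \<and> \<pi> i > \<pi> (i + 1)}"

definition D :: "nat \<Rightarrow> nat set \<Rightarrow> (nat \<Rightarrow> nat) set" where
  "D n S = {\<pi>. \<pi> permutes {1..n} \<and> Des n \<pi> = S}"

definition d :: "nat \<Rightarrow> nat set \<Rightarrow> nat" where
  "d n S = card (D n S)"

end

theory Submission
  imports Defs
begin

text \<open>
  The idea is to refine the count by the last letter.  Let \<open>a\<^sub>n(r)\<close> be the number of
  permutations of \<open>[n]\<close> whose descents are exactly the elements of \<open>S\<close> below \<open>n\<close> and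
  whose last letter is \<open>r\<close>.  Appending a letter \<open>r\<close> to a permutation of \<open>[n]\<close> that ends
  in \<open>s\<close>, and raising the letters \<open>\<ge> r\<close> by one, creates a descent at \<open>n\<close> iff \<open>s \<ge> r\<close>.
  Hence \<open>a\<^sub>n\<^sub>+\<^sub>1\<close> consists of the sums of \<open>a\<^sub>n\<close> over \<open>s \<ge> r\<close> if \<open>n \<in> S\<close>, and over
  \<open>s < r\<close> otherwise (\<open>d_ending_Suc\<close>).  Both operations preserve log-concavity without
  internal zeros, so every \<open>a\<^sub>n\<close> is log-concave as a function of \<open>r\<close>
  (\<open>log_concave_d_ending\<close>).

  To pass from log-concavity in \<open>r\<close> to log-concavity in \<open>n\<close>, suppose
  \<open>d\<^sub>n\<^sub>-\<^sub>1(S) \<noteq> 0\<close>, so that \<open>S\<close> lies below \<open>n - 1\<close>.  Put \<open>g = a\<^sub>n\<close>, let \<open>G\<close> be the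
  sequence of partial sums of \<open>g\<close> and \<open>H\<close> that of \<open>G\<close>.  Since a largest last letter
  can be dropped without changing the descent set, and since the recursion takes
  lower sums at \<open>n\<close> and at \<open>n + 1\<close>, the three numbers \<open>d\<^sub>n\<^sub>-\<^sub>1(S)\<close>,
  \<open>d\<^sub>n(S)\<close>, \<open>d\<^sub>n\<^sub>+\<^sub>1(S)\<close> are \<open>g(n)\<close>, \<open>G(n)\<close>, \<open>H(n)\<close>.  For log-concave \<open>g\<close> the quotient
  \<open>G / g\<close> is nondecreasing, that is \<open>G(i) g(n) \<le> G(n) g(i)\<close> for \<open>i \<le> n\<close>; summation over
  \<open>i\<close> yields \<open>H(n) g(n) \<le> G(n)\<^sup>2\<close> (\<open>log_concave_iterated_sums\<close>).
\<close>

section \<open>Log-concave sequences and their partial sums\<close>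

text \<open>
  The inequality for all shifts \<open>k\<close>, rather than only \<open>g(i)\<^sup>2 \<ge> g(i-1) g(i+1)\<close>, excludes
  internal zeros; partial sums of a sequence that has internal zeros need not be
  log-concave.
\<close>

definition log_concave :: "(nat \<Rightarrow> nat) \<Rightarrow> bool" where
  "log_concave g \<longleftrightarrow> (\<forall>i j k. i \<le> j \<longrightarrow> g i * g (j + k) \<le> g (i + k) * g j)"

lemma log_concaveD: "log_concave g \<Longrightarrow> i \<le> j \<Longrightarrow> g i * g (j + k) \<le> g (i + k) * g j"
  by (simp add: log_concave_def)

lemma log_concave_restrict:
  assumes "log_concave g"
  shows "log_concave (\<lambda>r. if a \<le> r \<and> r \<le> b then g r else 0)"
  using assms unfolding log_concave_def by auto

text \<open>
  Termwise comparison: each product on the left is moved inwards by \<open>j - i\<close>, and the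
  products so obtained occur on the right.
\<close>

lemma log_concave_sum_lessThan_mult:
  assumes g: "log_concave g" and "i \<le> j"
  shows "(\<Sum>s<i. g s) * g (j + t) \<le> g (i + t) * (\<Sum>s<j. g s)"
proof -
  have "(\<Sum>s<i. g s) * g (j + t) = (\<Sum>s<i. g s * g (i + t + (j - i)))"
    using \<open>i \<le> j\<close> by (simp add: sum_distrib_right algebra_simps)
  also have "\<dots> \<le> (\<Sum>s<i. g (s + (j - i)) * g (i + t))"
    by (intro sum_mono log_concaveD[OF g]) auto
  also have "\<dots> = (\<Sum>s\<in>(\<lambda>s. s + (j - i)) ` {..<i}. g s * g (i + t))"
    by (subst sum.reindex) (auto simp: inj_on_def)
  also have "\<dots> \<le> (\<Sum>s<j. g s * g (i + t))"
    using \<open>i \<le> j\<close> by (intro sum_mono2) auto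
  finally show ?thesis by (simp add: sum_distrib_right mult.commute)
qed

lemma log_concave_sum_lessThan:
  assumes g: "log_concave g"
  shows "log_concave (\<lambda>r. \<Sum>s<r. g s)"
  unfolding log_concave_def
proof (intro allI impI)
  fix i j k :: nat assume ij: "i \<le> j"
  have split: "(\<Sum>s<m + k. g s) = (\<Sum>s<m. g s) + (\<Sum>t<k. g (m + t))" for m
    by (induction k) auto
  have "(\<Sum>s<i. g s) * (\<Sum>t<k. g (j + t)) \<le> (\<Sum>t<k. g (i + t)) * (\<Sum>s<j. g s)"
    unfolding sum_distrib_left[of _ _ "{..<k}"] sum_distrib_right[of _ "{..<k}"]
    by (intro sum_mono log_concave_sum_lessThan_mult[OF g ij])
  \<comment> \<open>Both sides share the product of the sums up to \<open>i\<close> and up to \<open>j\<close>, which cancels.\<close>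
  then show "(\<Sum>s<i. g s) * (\<Sum>s<j + k. g s) \<le> (\<Sum>s<i + k. g s) * (\<Sum>s<j. g s)"
    unfolding split by (simp add: algebra_simps)
qed

text \<open>
  The counterpart for upper sums: \<open>t < k\<close> puts \<open>i + t\<close> below the whole range of summation,
  so that products can again be moved inwards by \<open>j - i\<close>.
\<close>

lemma log_concave_mult_sum_atLeastAtMost:
  assumes g: "log_concave g" and "i \<le> j" and "t < k"
  shows "g (i + t) * (\<Sum>s=j+k..n. g s) \<le> (\<Sum>s=i+k..n. g s) * g (j + t)"
proof -
  have "g (i + t) * (\<Sum>s=j+k..n. g s) \<le> (\<Sum>s=j+k..n. g (s - (j - i)) * g (j + t))"
    unfolding sum_distrib_left
  proof (intro sum_mono)
    fix s assume "s \<in> {j + k..n}"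
    then have "i + t \<le> s - (j - i)" and "s - (j - i) + (j - i) = s"
        and "i + t + (j - i) = j + t"
      using assms by auto
    then show "g (i + t) * g s \<le> g (s - (j - i)) * g (j + t)"
      using log_concaveD[OF g, of "i + t" "s - (j - i)" "j - i"] by (simp add: ac_simps)
  qed
  also have "\<dots> = (\<Sum>s\<in>(\<lambda>s. s - (j - i)) ` {j+k..n}. g s * g (j + t))"
    by (subst sum.reindex) (auto simp: inj_on_def)
  also have "\<dots> \<le> (\<Sum>s=i+k..n. g s * g (j + t))"
    using \<open>i \<le> j\<close> by (intro sum_mono2) auto
  finally show ?thesis by (simp add: sum_distrib_right)
qed

lemma log_concave_sum_atLeastAtMost:
  assumes g: "log_concave g" and supp: "\<And>s. s > n \<Longrightarrow> g s = 0"
  shows "log_concave (\<lambda>r. \<Sum>s=r..n. g s)"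
  unfolding log_concave_def
proof (intro allI impI)
  fix i j k :: nat assume ij: "i \<le> j"
  have split: "(\<Sum>s=m..n. g s) = (\<Sum>t<k. g (m + t)) + (\<Sum>s=m+k..n. g s)" for m
  proof (induction k)
    case (Suc k)
    have "(\<Sum>s=m+k..n. g s) = g (m + k) + (\<Sum>s=m + Suc k..n. g s)"
      using supp[of "m + k"] by (cases "m + k \<le> n") (auto simp: sum.atLeast_Suc_atMost)
    with Suc show ?case by simp
  qed simp
  have "(\<Sum>t<k. g (i + t)) * (\<Sum>s=j+k..n. g s) \<le> (\<Sum>s=i+k..n. g s) * (\<Sum>t<k. g (j + t))"
    unfolding sum_distrib_left[of _ _ "{..<k}"] sum_distrib_right[of _ "{..<k}"]
    by (intro sum_mono log_concave_mult_sum_atLeastAtMost[OF g ij]) auto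
  \<comment> \<open>Here the product of the sums from \<open>i + k\<close> and from \<open>j + k\<close> cancels.\<close>
  then show "(\<Sum>s=i..n. g s) * (\<Sum>s=j+k..n. g s) \<le> (\<Sum>s=i+k..n. g s) * (\<Sum>s=j..n. g s)"
    unfolding split[of i] split[of j] by (simp add: algebra_simps)
qed

text \<open>
  The partial sums of \<open>g\<close> grow at least as fast as \<open>g\<close> itself, so the quotient of the
  former by the latter is largest at \<open>n\<close>; summing this comparison gives the claim.
\<close>

lemma log_concave_iterated_sums:
  assumes g: "log_concave g"
  shows "g n * (\<Sum>i\<le>n. \<Sum>s\<le>i. g s) \<le> (\<Sum>s\<le>n. g s)\<^sup>2"
proof -
  have "g n * (\<Sum>i\<le>n. \<Sum>s\<le>i. g s) \<le> (\<Sum>i\<le>n. g i * (\<Sum>s\<le>n. g s))"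
    unfolding sum_distrib_left[of _ _ "{..n}"]
  proof (intro sum_mono, unfold sum_distrib_left[symmetric])
    fix i assume "i \<in> {..n}"
    then have "(\<Sum>s<i. g s) * g n \<le> g i * (\<Sum>s<n. g s)"
      using log_concave_sum_lessThan_mult[OF g, of i n 0] by simp
    then show "g n * (\<Sum>s\<le>i. g s) \<le> g i * (\<Sum>s\<le>n. g s)"
      by (simp add: algebra_simps flip: lessThan_Suc_atMost)
  qed
  then show ?thesis
    by (simp add: power2_eq_square sum_distrib_right)
qed

section \<open>Permutations counted by their last letter\<close>

text \<open>
  Intersecting \<open>S\<close> with \<open>{1..<n}\<close> lets one fixed \<open>S\<close> serve for all \<open>n\<close>, so that the
  counts can be computed by recursion on \<open>n\<close>.
\<close>

definition D_ending :: "nat \<Rightarrow> nat set \<Rightarrow> nat \<Rightarrow> (nat \<Rightarrow> nat) set" where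
  "D_ending n S r = {\<pi>. \<pi> permutes {1..n} \<and> Des n \<pi> = S \<inter> {1..<n} \<and> \<pi> n = r}"

definition d_ending :: "nat \<Rightarrow> nat set \<Rightarrow> nat \<Rightarrow> nat" where
  "d_ending n S r = card (D_ending n S r)"

lemma finite_D_ending: "finite (D_ending n S r)"
  by (rule finite_subset[OF _ finite_permutations[of "{1..n}"]]) (auto simp: D_ending_def)

lemma d_ending_eq_0:
  assumes "n \<ge> 1" "r \<notin> {1..n}"
  shows "d_ending n S r = 0"
proof -
  have "D_ending n S r = {}"
    using assms permutes_in_image[of _ "{1..n}" n] by (auto simp: D_ending_def)
  then show ?thesis by (simp add: d_ending_def)
qed

text \<open>
  The cycle that inserts \<open>r\<close> at the end: composing a permutation of \<open>[n]\<close> with it on the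
  left appends the letter \<open>r\<close> and raises the letters \<open>\<ge> r\<close> by one.
\<close>

definition raise_from :: "nat \<Rightarrow> nat \<Rightarrow> nat \<Rightarrow> nat" where
  "raise_from n r i = (if i = Suc n then r else if r \<le> i \<and> i \<le> n then Suc i else i)"

lemma raise_from_permutes:
  assumes "r \<in> {1..Suc n}"
  shows "raise_from n r permutes {1..Suc n}"
proof (rule bij_imp_permutes)
  have inj: "inj_on (raise_from n r) {1..Suc n}"
    using assms by (auto simp: inj_on_def raise_from_def split: if_splits)
  moreover have "raise_from n r ` {1..Suc n} \<subseteq> {1..Suc n}"
    using assms by (auto simp: raise_from_def)
  ultimately show "bij_betw (raise_from n r) {1..Suc n} {1..Suc n}"
    by (simp add: bij_betw_def endo_inj_surj)
qed (use assms in \<open>auto simp: raise_from_def\<close>)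

lemma Des_raise_from:
  assumes \<sigma>: "\<sigma> permutes {1..n}" and "n \<ge> 1" "r \<in> {1..Suc n}"
  shows "Des (Suc n) (raise_from n r \<circ> \<sigma>) = Des n \<sigma> \<union> (if r \<le> \<sigma> n then {n} else {})"
proof -
  have le: "\<sigma> i \<le> n" if "1 \<le> i" "i \<le> n" for i
    using permutes_in_image[OF \<sigma>, of i] that by auto
  have last: "\<sigma> (Suc n) = Suc n"
    using permutes_not_in[OF \<sigma>] by simp
  have mono: "raise_from n r x > raise_from n r y \<longleftrightarrow> x > y" if "x \<le> n" "y \<le> n" for x y
    using that by (auto simp: raise_from_def)
  have at_n: "raise_from n r (\<sigma> n) > raise_from n r (\<sigma> (Suc n)) \<longleftrightarrow> r \<le> \<sigma> n"
    using le[of n] \<open>n \<ge> 1\<close> last by (auto simp: raise_from_def)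
  have "i \<in> Des (Suc n) (raise_from n r \<circ> \<sigma>)
          \<longleftrightarrow> i \<in> Des n \<sigma> \<union> (if r \<le> \<sigma> n then {n} else {})" for i
    using mono[of "\<sigma> i" "\<sigma> (Suc i)"] le[of i] le[of "Suc i"] at_n \<open>n \<ge> 1\<close>
    by (cases "i = n") (auto simp: Des_def)
  then show ?thesis by blast
qed

text \<open>
  Every permutation of \<open>[n+1]\<close> ending in \<open>r\<close> arises from exactly one permutation of \<open>[n]\<close>
  by appending \<open>r\<close>; membership of \<open>n\<close> in \<open>S\<close> decides on which side of \<open>r\<close> the old last
  letter lies.
\<close>

lemma d_ending_Suc:
  assumes "n \<ge> 1" and r: "r \<in> {1..Suc n}"
  shows "d_ending (Suc n) S r =
    (if n \<in> S then \<Sum>s=r..n. d_ending n S s else \<Sum>s<r. d_ending n S s)"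
proof -
  define R where "R = (if n \<in> S then {r..n} else {..<r})"
  let ?c = "raise_from n r"
  have c: "?c permutes {1..Suc n}" by (rule raise_from_permutes[OF r])
  \<comment> \<open>Below \<open>n\<close> the descents are unchanged; \<open>R\<close> makes the one at \<open>n\<close> agree with \<open>S\<close>.\<close>
  have descents: "Des (Suc n) (?c \<circ> \<sigma>) = S \<inter> {1..<Suc n} \<longleftrightarrow>
      Des n \<sigma> = S \<inter> {1..<n} \<and> \<sigma> n \<in> R" if \<sigma>: "\<sigma> permutes {1..n}" for \<sigma>
  proof -
    have "\<sigma> n \<le> n"
      using permutes_in_image[OF \<sigma>, of n] \<open>n \<ge> 1\<close> by auto
    then have R: "\<sigma> n \<in> R \<longleftrightarrow> (r \<le> \<sigma> n \<longleftrightarrow> n \<in> S)" by (auto simp: R_def)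
    have "n \<notin> Des n \<sigma>" by (simp add: Des_def)
    moreover have "S \<inter> {1..<Suc n} = S \<inter> {1..<n} \<union> (if n \<in> S then {n} else {})"
      using \<open>n \<ge> 1\<close> by (auto simp: less_Suc_eq)
    ultimately show ?thesis
      unfolding Des_raise_from[OF \<sigma> \<open>n \<ge> 1\<close> r] R by auto
  qed
  have "D_ending (Suc n) S r = (\<lambda>\<sigma>. ?c \<circ> \<sigma>) ` (\<Union>s\<in>R. D_ending n S s)"
  proof (intro equalityI subsetI)
    fix \<pi> assume "\<pi> \<in> D_ending (Suc n) S r"
    then have \<pi>: "\<pi> permutes {1..Suc n}" "Des (Suc n) \<pi> = S \<inter> {1..<Suc n}" "\<pi> (Suc n) = r"
      by (auto simp: D_ending_def)
    define \<sigma> where "\<sigma> = inv ?c \<circ> \<pi>"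
    have \<pi>_eq: "\<pi> = ?c \<circ> \<sigma>"
      using permutes_inv_o(1)[OF c] by (simp add: \<sigma>_def flip: o_assoc) (simp add: o_assoc)
    have "?c (Suc n) = r" by (simp add: raise_from_def)
    then have "\<sigma> (Suc n) = Suc n"
      using \<pi>(3) permutes_inverses(2)[OF c, of "Suc n"] by (simp add: \<sigma>_def)
    moreover have "\<sigma> permutes {1..Suc n}"
      unfolding \<sigma>_def by (intro permutes_compose \<pi> permutes_inv c)
    ultimately have \<sigma>: "\<sigma> permutes {1..n}"
      by (auto intro: permutes_superset simp: le_Suc_eq)
    show "\<pi> \<in> (\<lambda>\<sigma>. ?c \<circ> \<sigma>) ` (\<Union>s\<in>R. D_ending n S s)"
      using descents[OF \<sigma>] \<pi>(2) \<sigma> by (auto simp: D_ending_def \<pi>_eq)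
  next
    fix \<pi> assume "\<pi> \<in> (\<lambda>\<sigma>. ?c \<circ> \<sigma>) ` (\<Union>s\<in>R. D_ending n S s)"
    then obtain \<sigma> where \<sigma>: "\<sigma> permutes {1..n}" "Des n \<sigma> = S \<inter> {1..<n}" "\<sigma> n \<in> R"
      and \<pi>: "\<pi> = ?c \<circ> \<sigma>"
      by (auto simp: D_ending_def)
    have "\<sigma> permutes {1..Suc n}"
      by (rule permutes_subset[OF \<sigma>(1)]) auto
    moreover have "\<sigma> (Suc n) = Suc n"
      using permutes_not_in[OF \<sigma>(1)] by simp
    then have "(?c \<circ> \<sigma>) (Suc n) = r"
      by (simp add: raise_from_def)
    ultimately show "\<pi> \<in> D_ending (Suc n) S r"
      using descents[OF \<sigma>(1)] \<sigma> c unfolding \<pi>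
      by (auto simp: D_ending_def intro: permutes_compose)
  qed
  moreover have "inj_on (\<lambda>\<sigma>. ?c \<circ> \<sigma>) A" for A
    using permutes_inj[OF c] by (auto simp: inj_on_def fun.inj_map_strong inj_def fun_eq_iff)
  moreover have "card (\<Union>s\<in>R. D_ending n S s) = (\<Sum>s\<in>R. d_ending n S s)"
    unfolding d_ending_def
    by (rule card_UN_disjoint) (auto simp: R_def finite_D_ending, auto simp: D_ending_def)
  ultimately have "d_ending (Suc n) S r = (\<Sum>s\<in>R. d_ending n S s)"
    by (metis card_image d_ending_def)
  then show ?thesis by (simp add: R_def)
qed

lemma log_concave_d_ending:
  assumes "n \<ge> 1"
  shows "log_concave (d_ending n S)"
  using assms
proof (induction n rule: dec_induct)
  case base
  have "d_ending 1 S = (\<lambda>r. if r = 1 then d_ending 1 S 1 else 0)"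
    using d_ending_eq_0[of 1 _ S] by (auto simp: fun_eq_iff)
  moreover have "log_concave (\<lambda>r. if r = 1 then c else 0)" for c
    by (auto simp: log_concave_def)
  ultimately show ?case by simp
next
  case (step n)
  define h where "h r = (if n \<in> S then \<Sum>s=r..n. d_ending n S s else \<Sum>s<r. d_ending n S s)" for r
  have "log_concave h"
    using step log_concave_sum_lessThan log_concave_sum_atLeastAtMost[of "d_ending n S" n]
      d_ending_eq_0[of n _ S]
    by (cases "n \<in> S") (simp_all add: h_def[abs_def])
  moreover have "d_ending (Suc n) S = (\<lambda>r. if 1 \<le> r \<and> r \<le> Suc n then h r else 0)"
    using d_ending_Suc[OF step(1), of _ S] d_ending_eq_0[of "Suc n" _ S]
    by (auto simp: fun_eq_iff h_def)
  ultimately show ?case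
    using log_concave_restrict[of h 1 "Suc n"] by simp
qed

section \<open>Log-concavity in the length\<close>

text \<open>
  A largest letter in last position never creates a descent, so it can be
  dropped.
\<close>

lemma d_eq_d_ending_Suc:
  assumes "S \<subseteq> {1..<n}"
  shows "d n S = d_ending (Suc n) S (Suc n)"
proof -
  have "\<pi> permutes {1..n} \<longleftrightarrow> \<pi> permutes {1..Suc n} \<and> \<pi> (Suc n) = Suc n" for \<pi>
    using permutes_subset[of \<pi> "{1..n}" "{1..Suc n}"] permutes_not_in[of \<pi> "{1..n}" "Suc n"]
      permutes_superset[of \<pi> "{1..Suc n}" "{1..n}"]
    by (auto simp: le_Suc_eq)
  moreover have "Des (Suc n) \<pi> = Des n \<pi>" if "\<pi> permutes {1..n}" for \<pi>
  proof -
    have "\<pi> n \<le> \<pi> (Suc n)"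
      using permutes_in_image[OF that, of n] permutes_not_in[OF that, of "Suc n"]
        permutes_not_in[OF that, of n]
      by (cases "n = 0") auto
    then show ?thesis by (auto simp: Des_def less_Suc_eq)
  qed
  moreover have "S \<inter> {1..<Suc n} = S" using assms by auto
  ultimately have "D n S = D_ending (Suc n) S (Suc n)"
    unfolding D_def D_ending_def by (metis (no_types, lifting))
  then show ?thesis by (simp add: d_def d_ending_def)
qed

theorem theorem6p7:
  fixes S :: "nat set" and n :: nat
  assumes "finite S"
    and "\<forall>i\<in>S. i \<ge> 1"
    and "n \<ge> 1"
  shows "(d n S)\<^sup>2 \<ge> d (n - 1) S * d (n + 1) S"
proof (cases "D (n - 1) S = {}")
  case True
  then show ?thesis by (simp add: d_def)
next
  case False
  then have S: "S \<subseteq> {1..<n - 1}" by (auto simp: D_def Des_def)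
  then have sub: "S \<subseteq> {1..<n}" "S \<subseteq> {1..<Suc n}" and notin: "n \<notin> S" "Suc n \<notin> S"
    by force+
  let ?g = "d_ending n S"
  have rec: "d_ending (Suc n) S (Suc i) = (\<Sum>s\<le>i. ?g s)" if "i \<le> n" for i
    using d_ending_Suc[of n "Suc i" S] that notin \<open>n \<ge> 1\<close> by (simp add: lessThan_Suc_atMost)
  have "d (n - 1) S = ?g n"
    using d_eq_d_ending_Suc[OF S] \<open>n \<ge> 1\<close> by simp
  moreover have "d n S = (\<Sum>s\<le>n. ?g s)"
    using d_eq_d_ending_Suc[OF sub(1)] rec[of n] by simp
  moreover have "d (n + 1) S = (\<Sum>i\<le>n. \<Sum>s\<le>i. ?g s)"
  proof -
    have "d (n + 1) S = (\<Sum>s<Suc (Suc n). d_ending (Suc n) S s)"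
      using d_eq_d_ending_Suc[OF sub(2)] d_ending_Suc[of "Suc n" "Suc (Suc n)" S] notin by simp
    also have "\<dots> = (\<Sum>i\<le>n. d_ending (Suc n) S (Suc i))"
      using d_ending_eq_0[of "Suc n" 0 S]
      by (subst sum.lessThan_Suc_shift) (simp add: lessThan_Suc_atMost)
    finally show ?thesis using rec by simp
  qed
  ultimately show ?thesis
    using log_concave_iterated_sums[OF log_concave_d_ending[OF \<open>n \<ge> 1\<close>, of S], of n] by simp
qed

end
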